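(* Suppose that the topological group $G$ is non-Archimedean and that open subgroups of $G$ have at most countable index. (Or equivalently, assume that the non-Archimedean group $G$ is countably generated over any identity neighborhood.) Then $G$ admits a geometry if and only if $G$ admits a Cayley–Abels–Rosendal graph.
   Context: A topological group is non-Archimedean if it has a neighborhood basis of the identity consisting of open subgroups. An identity neighborhood is a subset of $G$ containing $1$ in its interior. $G$ is countably generated over any identity neighborhood if for every identity neighborhood $U$ there exists a countable set $C\subset G$ such that $U\cup C$ generates $G$. $\mathrm{PMet}(G)$ is the set of continuous, left-invariant pseudometrics $d:G\times G\to\mathbb{R}$ (distinct points may have distance $0$). For $d,d'\in\mathrm{PMet}(G)$, $d\succeq d'$ means there are $L>0$, $K\ge 0$ with $d'(g,h)\le L\,d(g,h)+K$ for all $g,h\in G$. $G$ admits a geometry if $\mathrm{PMet}(G)$ has a maximum element with respect to $\succeq$, i.e. an element dominating every other element. A subset $A\subset G$ is coarsely bounded in $G$ if it has finite $d$-diameter for every $d\in\mathrm{PMet}(G)$. A Cayley–Abels–Rosendal graph for $G$ is a connected, countable graph on which $G$ acts by graph automorphisms continuously, vertex-transitively, with finitely many orbits of edges and with vertex stabilizers coarsely bounded in $G$.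
   Formalization: The parenthetical equivalence fails (e.g. Sym(X), X uncountable), and so does the claim under the second assumption alone; the formal statement assumes open subgroups have at most countable index and proves only that this implies countable generation over any identity neighborhood. *)

theory Defs
  imports
    "HOL-Analysis.Analysis"
    "HOL-Algebra.Group_Action"
    "HOL-Algebra.Generated_Groups"
begin

text \<open>No separation axiom is part of the definition.\<close>

locale topological_group = group G for G (structure) +
  fixes T :: "'a topology"
  assumes topspace_eq: "topspace T = carrier G"
    and continuous_mult: "continuous_map (prod_topology T T) T (\<lambda>(x, y). x \<otimes> y)"
    and continuous_inv: "continuous_map T T (\<lambda>x. inv x)"

definition identity_nbhd :: "('a, 'b) monoid_scheme \<Rightarrow> 'a topology \<Rightarrow> 'a set \<Rightarrow> bool" where
  "identity_nbhd G T U \<longleftrightarrow> U \<subseteq> carrier G \<and> \<one>\<^bsub>G\<^esub> \<in> T interior_of U"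

definition non_archimedean :: "('a, 'b) monoid_scheme \<Rightarrow> 'a topology \<Rightarrow> bool" where
  "non_archimedean G T \<longleftrightarrow>
     (\<forall>U. identity_nbhd G T U \<longrightarrow> (\<exists>H. subgroup H G \<and> openin T H \<and> H \<subseteq> U))"

definition open_subgroups_countable_index :: "('a, 'b) monoid_scheme \<Rightarrow> 'a topology \<Rightarrow> bool" where
  "open_subgroups_countable_index G T \<longleftrightarrow>
     (\<forall>H. subgroup H G \<and> openin T H \<longrightarrow> countable (rcosets\<^bsub>G\<^esub> H))"

definition countably_generated_over_nbhds :: "('a, 'b) monoid_scheme \<Rightarrow> 'a topology \<Rightarrow> bool" where
  "countably_generated_over_nbhds G T \<longleftrightarrow>
     (\<forall>U. identity_nbhd G T U \<longrightarrow>
        (\<exists>C. C \<subseteq> carrier G \<and> countable C \<and> generate G (U \<union> C) = carrier G))"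

text \<open>Elements of \<open>PMet G T\<close> are total functions on the type; only their values on
  \<open>carrier G \<times> carrier G\<close> matter, and everything below looks only at those.\<close>

definition PMet :: "('a, 'b) monoid_scheme \<Rightarrow> 'a topology \<Rightarrow> ('a \<Rightarrow> 'a \<Rightarrow> real) set" where
  "PMet G T = {d.
     (\<forall>x\<in>carrier G. \<forall>y\<in>carrier G. 0 \<le> d x y) \<and>
     (\<forall>x\<in>carrier G. d x x = 0) \<and>
     (\<forall>x\<in>carrier G. \<forall>y\<in>carrier G. d x y = d y x) \<and>
     (\<forall>x\<in>carrier G. \<forall>y\<in>carrier G. \<forall>z\<in>carrier G. d x z \<le> d x y + d y z) \<and>
     (\<forall>g\<in>carrier G. \<forall>x\<in>carrier G. \<forall>y\<in>carrier G. d (g \<otimes>\<^bsub>G\<^esub> x) (g \<otimes>\<^bsub>G\<^esub> y) = d x y) \<and>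
     continuous_map (prod_topology T T) euclideanreal (\<lambda>(x, y). d x y)}"

definition dominates ::
    "('a, 'b) monoid_scheme \<Rightarrow> ('a \<Rightarrow> 'a \<Rightarrow> real) \<Rightarrow> ('a \<Rightarrow> 'a \<Rightarrow> real) \<Rightarrow> bool" where
  "dominates G d d' \<longleftrightarrow>
     (\<exists>L>0. \<exists>K\<ge>0. \<forall>g\<in>carrier G. \<forall>h\<in>carrier G. d' g h \<le> L * d g h + K)"

definition admits_geometry :: "('a, 'b) monoid_scheme \<Rightarrow> 'a topology \<Rightarrow> bool" where
  "admits_geometry G T \<longleftrightarrow> (\<exists>d\<in>PMet G T. \<forall>d'\<in>PMet G T. dominates G d d')"

definition coarsely_bounded :: "('a, 'b) monoid_scheme \<Rightarrow> 'a topology \<Rightarrow> 'a set \<Rightarrow> bool" where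
  "coarsely_bounded G T A \<longleftrightarrow>
     A \<subseteq> carrier G \<and> (\<forall>d\<in>PMet G T. \<exists>D. \<forall>x\<in>A. \<forall>y\<in>A. d x y \<le> D)"

text \<open>Graphs are simple and undirected, of arbitrary cardinality; an edge is the set of its
  two end points. A connected graph has at least one vertex: otherwise the empty graph would
  satisfy every condition on a Cayley--Abels--Rosendal graph.\<close>

definition simple_graph :: "'v set \<Rightarrow> 'v set set \<Rightarrow> bool" where
  "simple_graph V E \<longleftrightarrow> (\<forall>e\<in>E. e \<subseteq> V \<and> card e = 2)"

definition connected_graph :: "'v set \<Rightarrow> 'v set set \<Rightarrow> bool" where
  "connected_graph V E \<longleftrightarrow>
     V \<noteq> {} \<and> (\<forall>u\<in>V. \<forall>v\<in>V. (u, v) \<in> {(x, y). {x, y} \<in> E}\<^sup>*)"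

text \<open>The action on the graph is given by its action \<open>\<phi>\<close> on vertices; \<open>g\<close> maps the edge \<open>e\<close>
  to \<open>\<phi> g ` e\<close>. As the action is by the group, preserving edges in one direction for all \<open>g\<close>
  already makes each \<open>\<phi> g\<close> an automorphism. Continuity refers to the discrete topology on
  vertices, i.e. it says that vertex stabilizers are open.\<close>

definition CAR_graph ::
    "('a, 'b) monoid_scheme \<Rightarrow> 'a topology \<Rightarrow> 'v set \<Rightarrow> 'v set set \<Rightarrow> ('a \<Rightarrow> 'v \<Rightarrow> 'v) \<Rightarrow> bool" where
  "CAR_graph G T V E \<phi> \<longleftrightarrow>
     simple_graph V E \<and> connected_graph V E \<and> countable V \<and>
     transitive_action G V \<phi> \<and>
     (\<forall>g\<in>carrier G. \<forall>e\<in>E. \<phi> g ` e \<in> E) \<and>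
     continuous_map (prod_topology T (discrete_topology V)) (discrete_topology V)
       (\<lambda>(g, v). \<phi> g v) \<and>
     finite (orbits G E (\<lambda>g e. \<phi> g ` e)) \<and>
     (\<forall>v\<in>V. coarsely_bounded G T (stabilizer G \<phi> v))"

text \<open>Every countable graph is isomorphic to one whose vertices are natural numbers, so fixing
  the vertex type loses no generality.\<close>

definition admits_CAR_graph :: "('a, 'b) monoid_scheme \<Rightarrow> 'a topology \<Rightarrow> bool" where
  "admits_CAR_graph G T \<longleftrightarrow>
     (\<exists>(V :: nat set) E \<phi>. CAR_graph G T V E \<phi>)"

end

theory Submission
  imports Defs
begin

text \<open>A non-Archimedean group with a geometry has an open coarsely bounded subgroup \<open>H\<close>: any open
  subgroup inside a ball of the maximal pseudometric will do
  (\<open>geometry_imp_open_coarsely_bounded_subgroup\<close>). The heart of the matter is that \<open>G\<close> is then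
  generated by \<open>H\<close> and finitely many elements. Since \<open>H\<close> has countable index, adding coset
  representatives one by one exhausts \<open>G\<close> by an increasing chain of open subgroups, and in the
  presence of a geometry such a chain must reach \<open>G\<close> at a finite stage: otherwise one could assign to its stages
  weights growing so fast that the resulting pseudometric is not dominated
  by the maximal one (\<open>geometry_imp_chain_reaches_group\<close>). With \<open>F\<close> finite and \<open>H \<union> F\<close>
  generating, the coset graph on \<open>G/H\<close> with edges \<open>{gH, gfH}\<close>, \<open>f \<in> F - H\<close>, is a Cayley--Abels--Rosendal graph
  (\<open>admits_CAR_graph_if_finitely_generated_over\<close>).

  Conversely, the graph distance between the translates of a base vertex is a pseudometric,
  continuous because the stabilizer of the vertex is open. It dominates every other one because,
  with finitely many orbits of edges and a coarsely bounded stabilizer, the cost of crossing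
  one edge is uniformly bounded (\<open>CAR_graph_imp_geometry\<close>).\<close>

section \<open>Invariant pseudometrics\<close>

lemma
  assumes "d \<in> PMet G T" "x \<in> carrier G"
  shows PMet_nonneg: "y \<in> carrier G \<Longrightarrow> 0 \<le> d x y"
    and PMet_refl: "d x x = 0"
    and PMet_sym: "y \<in> carrier G \<Longrightarrow> d x y = d y x"
    and PMet_triangle: "y \<in> carrier G \<Longrightarrow> z \<in> carrier G \<Longrightarrow> d x z \<le> d x y + d y z"
    and PMet_invariant: "y \<in> carrier G \<Longrightarrow> g \<in> carrier G \<Longrightarrow> d (g \<otimes>\<^bsub>G\<^esub> x) (g \<otimes>\<^bsub>G\<^esub> y) = d x y"
  using assms unfolding PMet_def by blast+

context topological_group
begin

lemma inv_mult_left_cancel: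
  assumes "g \<in> carrier G" "x \<in> carrier G" "y \<in> carrier G"
  shows "inv (g \<otimes> x) \<otimes> (g \<otimes> y) = inv x \<otimes> y"
proof -
  have "inv g \<otimes> (g \<otimes> y) = y"
    using assms by (simp add: m_assoc[symmetric])
  then show ?thesis
    using assms by (simp add: inv_mult_group m_assoc)
qed

lemma openin_lcoset:
  assumes "openin T H" "x \<in> carrier G"
  shows "openin T {y \<in> carrier G. inv x \<otimes> y \<in> H}"
proof -
  have "continuous_map T (prod_topology T T) (\<lambda>y. (inv x, y))"
    using assms(2) by (simp add: continuous_map_pairwise o_def topspace_eq)
  from continuous_map_compose[OF this continuous_mult]
  have "continuous_map T T (\<lambda>y. inv x \<otimes> y)"
    by (simp add: o_def)
  from openin_continuous_map_preimage[OF this assms(1)] show ?thesis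
    by (simp add: topspace_eq)
qed

text \<open>A subgroup is a union of cosets of any subgroup that it contains.\<close>

lemma openin_supergroup:
  assumes "subgroup H G" "openin T H" "subgroup K G" "H \<subseteq> K"
  shows "openin T K"
proof (subst openin_subopen, intro ballI)
  interpret H: subgroup H G by fact
  interpret K: subgroup K G by fact
  fix x assume x: "x \<in> K"
  have "{y \<in> carrier G. inv x \<otimes> y \<in> H} \<subseteq> K"
  proof clarify
    fix y assume y: "y \<in> carrier G" "inv x \<otimes> y \<in> H"
    then have "x \<otimes> (inv x \<otimes> y) \<in> K"
      using x assms(4) by blast
    then show "y \<in> K"
      using x y by (simp add: m_assoc[symmetric])
  qed
  then show "\<exists>U. openin T U \<and> x \<in> U \<and> U \<subseteq> K"
    using x openin_lcoset[OF assms(2), of x] by (intro exI[of _ "{y \<in> carrier G. inv x \<otimes> y \<in> H}"]) auto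
qed

text \<open>Vanishing on an open subgroup \<open>H\<close> makes a left-invariant pseudometric constant on every
  product \<open>xH \<times> yH\<close>, so continuity needs no estimate.\<close>

lemma PMet_if_vanishing_on_open_subgroup:
  assumes nonneg: "\<And>x y. x \<in> carrier G \<Longrightarrow> y \<in> carrier G \<Longrightarrow> 0 \<le> d x y"
    and refl: "\<And>x. x \<in> carrier G \<Longrightarrow> d x x = 0"
    and sym: "\<And>x y. x \<in> carrier G \<Longrightarrow> y \<in> carrier G \<Longrightarrow> d x y = d y x"
    and triangle: "\<And>x y z. x \<in> carrier G \<Longrightarrow> y \<in> carrier G \<Longrightarrow> z \<in> carrier G \<Longrightarrow>
      d x z \<le> d x y + d y z"
    and invariant: "\<And>g x y. g \<in> carrier G \<Longrightarrow> x \<in> carrier G \<Longrightarrow> y \<in> carrier G \<Longrightarrow>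
      d (g \<otimes> x) (g \<otimes> y) = d x y"
    and H: "subgroup H G" "openin T H"
    and vanish: "\<And>h. h \<in> H \<Longrightarrow> d \<one> h = (0::real)"
  shows "d \<in> PMet G T"
proof -
  interpret H: subgroup H G by fact
  have zero: "d x x' = 0" if "x \<in> carrier G" "x' \<in> carrier G" "inv x \<otimes> x' \<in> H" for x x'
    using invariant[of "inv x" x x'] vanish that by simp
  have const: "d x' y' = d x y"
    if "x \<in> carrier G" "x' \<in> carrier G" "inv x \<otimes> x' \<in> H"
      "y \<in> carrier G" "y' \<in> carrier G" "inv y \<otimes> y' \<in> H" for x x' y y'
    using zero[of x x'] zero[of y y'] triangle[of x' x y'] triangle[of x y y']
      triangle[of x x' y] triangle[of x' y' y] sym[of x x'] sym[of y y'] that by linarith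
  have "continuous_map (prod_topology T T) euclideanreal (\<lambda>(x, y). d x y)"
    unfolding continuous_map_def
  proof (intro conjI allI impI)
    fix U :: "real set"
    show "openin (prod_topology T T)
        {p \<in> topspace (prod_topology T T). (case p of (x, y) \<Rightarrow> d x y) \<in> U}"
      unfolding openin_prod_topology_alt
    proof (intro allI impI)
      fix x y
      assume "(x, y) \<in> {p \<in> topspace (prod_topology T T). (case p of (x, y) \<Rightarrow> d x y) \<in> U}"
      then have xy: "x \<in> carrier G" "y \<in> carrier G" "d x y \<in> U"
        by (auto simp: topspace_eq)
      show "\<exists>A B. openin T A \<and> openin T B \<and> x \<in> A \<and> y \<in> B \<and>
          A \<times> B \<subseteq> {p \<in> topspace (prod_topology T T). (case p of (x, y) \<Rightarrow> d x y) \<in> U}"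
      proof (intro exI conjI subsetI)
        fix p assume "p \<in> {z \<in> carrier G. inv x \<otimes> z \<in> H} \<times> {z \<in> carrier G. inv y \<otimes> z \<in> H}"
        then obtain x' y' where p: "p = (x', y')" "x' \<in> carrier G" "inv x \<otimes> x' \<in> H"
          "y' \<in> carrier G" "inv y \<otimes> y' \<in> H" by blast
        then have "d x' y' \<in> U"
          using const[of x x' y y'] xy by simp
        with p show "p \<in> {p \<in> topspace (prod_topology T T). (case p of (x, y) \<Rightarrow> d x y) \<in> U}"
          by (simp add: topspace_eq)
      qed (use xy openin_lcoset[OF H(2)] in auto)
    qed
  qed auto
  then show ?thesis
    unfolding PMet_def
    by (intro CollectI conjI ballI nonneg refl sym triangle invariant)
qed

lemma coarsely_bounded_conjugate:
  assumes A: "coarsely_bounded G T A" and a: "a \<in> carrier G"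
  shows "coarsely_bounded G T {g \<in> carrier G. inv a \<otimes> g \<otimes> a \<in> A}"
  unfolding coarsely_bounded_def
proof (intro conjI ballI)
  fix d assume d: "d \<in> PMet G T"
  then obtain D where D: "\<And>x y. x \<in> A \<Longrightarrow> y \<in> A \<Longrightarrow> d x y \<le> D"
    using A unfolding coarsely_bounded_def by blast
  show "\<exists>D. \<forall>x\<in>{g \<in> carrier G. inv a \<otimes> g \<otimes> a \<in> A}. \<forall>y\<in>{g \<in> carrier G. inv a \<otimes> g \<otimes> a \<in> A}. d x y \<le> D"
  proof (intro exI ballI)
    fix x y
    assume "x \<in> {g \<in> carrier G. inv a \<otimes> g \<otimes> a \<in> A}" "y \<in> {g \<in> carrier G. inv a \<otimes> g \<otimes> a \<in> A}"
    then have x: "x \<in> carrier G" "inv a \<otimes> x \<otimes> a \<in> A"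
      and y: "y \<in> carrier G" "inv a \<otimes> y \<otimes> a \<in> A" by auto
    have "d (x \<otimes> a) (y \<otimes> a) = d (inv a \<otimes> (x \<otimes> a)) (inv a \<otimes> (y \<otimes> a))"
      using PMet_invariant[OF d] x y a by simp
    also have "\<dots> \<le> D"
      using D x y a by (simp add: m_assoc)
    finally have 1: "d (x \<otimes> a) (y \<otimes> a) \<le> D" .
    have 2: "d z (z \<otimes> a) = d \<one> a" if "z \<in> carrier G" for z
      using PMet_invariant[OF d, of \<one> a z] that a by simp
    show "d x y \<le> D + 2 * d \<one> a"
      using 1 2[OF x(1)] 2[OF y(1)] PMet_triangle[OF d x(1), of "x \<otimes> a" y]
        PMet_triangle[OF d, of "x \<otimes> a" "y \<otimes> a" y] PMet_sym[OF d y(1), of "y \<otimes> a"] x y a by simp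
  qed
qed blast

end

section \<open>From a geometry to a Cayley--Abels--Rosendal graph\<close>

context topological_group
begin

text \<open>Domination makes a ball of the maximal pseudometric coarsely bounded, and the topology puts an
  open subgroup inside the ball.\<close>

lemma geometry_imp_open_coarsely_bounded_subgroup:
  assumes na: "non_archimedean G T" and geom: "admits_geometry G T"
  obtains H where "subgroup H G" "openin T H" "coarsely_bounded G T H"
proof -
  obtain d where d: "d \<in> PMet G T" "\<And>d'. d' \<in> PMet G T \<Longrightarrow> dominates G d d'"
    using geom unfolding admits_geometry_def by blast
  have "continuous_map T (prod_topology T T) (\<lambda>y. (\<one>, y))"
    by (simp add: continuous_map_pairwise o_def topspace_eq)
  moreover have "continuous_map (prod_topology T T) euclideanreal (\<lambda>(x, y). d x y)"
    using d unfolding PMet_def by blast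
  ultimately have "continuous_map T euclideanreal (\<lambda>y. d \<one> y)"
    by (auto dest: continuous_map_compose simp: o_def)
  then have "openin T {y \<in> topspace T. d \<one> y \<in> {..<1}}"
    by (rule openin_continuous_map_preimage) simp
  then have U: "openin T {y \<in> carrier G. d \<one> y < 1}"
    by (simp add: topspace_eq)
  then have "identity_nbhd G T {y \<in> carrier G. d \<one> y < 1}"
    using PMet_refl[OF d(1), of \<one>] by (simp add: identity_nbhd_def interior_of_openin)
  then obtain H where H: "subgroup H G" "openin T H" "H \<subseteq> {y \<in> carrier G. d \<one> y < 1}"
    using na unfolding non_archimedean_def by blast
  have "coarsely_bounded G T H"
    unfolding coarsely_bounded_def
  proof (intro conjI ballI)
    show "H \<subseteq> carrier G" using H by blast
    fix d' assume "d' \<in> PMet G T"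
    then obtain L K where LK: "L > 0" "\<And>g h. g \<in> carrier G \<Longrightarrow> h \<in> carrier G \<Longrightarrow> d' g h \<le> L * d g h + K"
      using d(2) unfolding dominates_def by blast
    show "\<exists>D. \<forall>x\<in>H. \<forall>y\<in>H. d' x y \<le> D"
    proof (intro exI ballI)
      fix x y assume "x \<in> H" "y \<in> H"
      then have xy: "x \<in> carrier G" "d \<one> x < 1" "y \<in> carrier G" "d \<one> y < 1"
        using H(3) by auto
      then have "d x y \<le> 2"
        using PMet_triangle[OF d(1), of x \<one> y] PMet_sym[OF d(1), of x \<one>] by simp
      then have "L * d x y \<le> L * 2"
        using LK(1) by simp
      then show "d' x y \<le> L * 2 + K"
        using LK(2)[of x y] xy by linarith
    qed
  qed
  with H that show thesis by blast
qed

text \<open>Give the elements of \<open>K (Suc n) - K n\<close> length \<open>w (Suc n)\<close>, for increasing weights \<open>w\<close>. As the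
  \<open>K n\<close> are nested subgroups, this is the length function of a left-invariant pseudometric
  whatever the weights are, so on a chain that never reaches \<open>G\<close> the weights can be made to grow
  faster than any affine function of a given pseudometric.\<close>

lemma geometry_imp_chain_reaches_group:
  assumes geom: "admits_geometry G T"
    and K: "\<And>n. subgroup (K n) G" "openin T (K 0)" "\<And>n. K n \<subseteq> K (Suc n)"
    and cover: "carrier G = (\<Union>n. K n)"
  shows "\<exists>n. K n = carrier G"
proof (rule ccontr)
  assume "\<nexists>n. K n = carrier G"
  then have "\<forall>n. \<exists>x. x \<in> carrier G \<and> x \<notin> K n"
    using cover by blast
  then obtain x where x: "\<And>n. x n \<in> carrier G" "\<And>n. x n \<notin> K n"
    by metis
  obtain d where d: "d \<in> PMet G T" "\<And>d'. d' \<in> PMet G T \<Longrightarrow> dominates G d d'"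
    using geom unfolding admits_geometry_def by blast
  note dpos = PMet_nonneg[OF d(1) one_closed x(1)]
  \<comment> \<open>The factor \<open>i\<close> outgrows the multiplicative constant of any domination, and the \<open>+ 1\<close>
    the additive one.\<close>
  define w :: "nat \<Rightarrow> real" where "w n = (\<Sum>i<n. real i * (d \<one> (x i) + 1))" for n
  have w_mono: "w m \<le> w n" if "m \<le> n" for m n
    unfolding w_def using that dpos by (intro sum_mono2) (auto simp: add_nonneg_nonneg)
  have w_nonneg: "0 \<le> w n" for n
    using w_mono[of 0 n] by (simp add: w_def)
  have w_Suc: "w (Suc n) \<ge> real n * (d \<one> (x n) + 1)" for n
    using w_nonneg[of n] by (simp add: w_def)
  have K_mono: "K m \<subseteq> K n" if "m \<le> n" for m n
    using lift_Suc_mono_le[of K, OF K(3) that] .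
  define lev where "lev z = (LEAST n. z \<in> K n)" for z
  have lev_mem: "z \<in> K (lev z)" if "z \<in> carrier G" for z
    unfolding lev_def using that cover by (auto intro: LeastI)
  have lev_le: "lev z \<le> n" if "z \<in> K n" for z n
    unfolding lev_def using that by (rule Least_le)
  have lev_mult: "lev (y \<otimes> z) \<le> max (lev y) (lev z)" if "y \<in> carrier G" "z \<in> carrier G" for y z
  proof (rule lev_le)
    show "y \<otimes> z \<in> K (max (lev y) (lev z))"
      using lev_mem[OF that(1)] lev_mem[OF that(2)] K_mono
      by (meson K(1) in_mono max.cobounded1 max.cobounded2 subgroup.m_closed)
  qed
  have lev_inv_le: "lev (inv z) \<le> lev z" if "z \<in> carrier G" for z
    using lev_le lev_mem[OF that] K(1) by (meson subgroup.m_inv_closed)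
  then have lev_inv: "lev (inv z) = lev z" if "z \<in> carrier G" for z
    using that by (metis antisym inv_closed inv_inv)
  have lev_0: "lev z = 0" if "z \<in> K 0" for z
    using lev_le[OF that] by simp
  define d' where "d' y z = w (lev (inv y \<otimes> z))" for y z
  have "d' \<in> PMet G T"
  proof (rule PMet_if_vanishing_on_open_subgroup[OF _ _ _ _ _ K(1)[of 0] K(2)])
    fix y z assume yz: "y \<in> carrier G" "z \<in> carrier G"
    show "0 \<le> d' y z"
      by (simp add: d'_def w_nonneg)
    have "inv (inv y \<otimes> z) = inv z \<otimes> y"
      using yz by (simp add: inv_mult_group)
    then show "d' y z = d' z y"
      unfolding d'_def using lev_inv[of "inv y \<otimes> z"] yz by simp
  next
    fix y assume "y \<in> carrier G"
    then show "d' y y = 0"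
      using lev_0[of \<one>] subgroup.one_closed[OF K(1)] by (simp add: d'_def w_def)
  next
    fix y z u assume yzu: "y \<in> carrier G" "z \<in> carrier G" "u \<in> carrier G"
    have eq: "inv y \<otimes> u = (inv y \<otimes> z) \<otimes> (inv z \<otimes> u)"
      using yzu by (simp add: m_assoc) (simp add: m_assoc[symmetric])
    have "w (lev (inv y \<otimes> u)) \<le> w (max (lev (inv y \<otimes> z)) (lev (inv z \<otimes> u)))"
      unfolding eq using yzu by (intro w_mono lev_mult) auto
    also have "\<dots> \<le> w (lev (inv y \<otimes> z)) + w (lev (inv z \<otimes> u))"
      using w_nonneg by (simp add: max_def)
    finally show "d' y u \<le> d' y z + d' z u"
      by (simp add: d'_def)
  next
    fix g y z assume gyz: "g \<in> carrier G" "y \<in> carrier G" "z \<in> carrier G"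
    then show "d' (g \<otimes> y) (g \<otimes> z) = d' y z"
      by (simp add: d'_def inv_mult_left_cancel)
  next
    fix h assume h: "h \<in> K 0"
    then have "h \<in> carrier G" using cover by blast
    then show "d' \<one> h = 0"
      using lev_0[OF h] by (simp add: d'_def w_def)
  qed
  then obtain L C where LC: "\<And>g h. g \<in> carrier G \<Longrightarrow> h \<in> carrier G \<Longrightarrow> d' g h \<le> L * d g h + C"
    using d(2) unfolding dominates_def by blast
  obtain n where n: "real n > max L C"
    using reals_Archimedean2 by blast
  have "Suc n \<le> lev (x n)"
    using lev_mem[OF x(1), of n] x(2)[of n] K_mono[of "lev (x n)" n] by (metis in_mono not_less_eq_eq)
  then have "real n * (d \<one> (x n) + 1) \<le> d' \<one> (x n)"
    using w_Suc[of n] w_mono[of "Suc n" "lev (x n)"] x(1)[of n] by (simp add: d'_def)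
  also have "\<dots> \<le> L * d \<one> (x n) + C"
    using LC x(1) by simp
  also have "\<dots> < real n * d \<one> (x n) + real n"
    using n dpos[of n] by (intro add_le_less_mono mult_right_mono) auto
  finally show False
    by (simp add: distrib_left)
qed

lemma countable_index_enumeration:
  assumes H: "subgroup H G" "countable (rcosets H)"
  obtains r :: "nat \<Rightarrow> 'a" where "range r \<subseteq> carrier G"
    "\<And>x. x \<in> carrier G \<Longrightarrow> \<exists>n. \<exists>h\<in>H. x = h \<otimes> r n"
proof -
  have ne: "rcosets H \<noteq> {}"
    using rcosetsI[OF subgroup.subset[OF H(1)] one_closed] by blast
  have "\<forall>n. \<exists>y. y \<in> carrier G \<and> from_nat_into (rcosets H) n = H #> y"
    using from_nat_into[OF ne] by (auto simp: RCOSETS_def)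
  then obtain r where r: "\<And>n. r n \<in> carrier G" "\<And>n. from_nat_into (rcosets H) n = H #> r n"
    by metis
  show thesis
  proof
    show "range r \<subseteq> carrier G" using r by blast
    fix x assume x: "x \<in> carrier G"
    then have "H #> x \<in> rcosets H"
      using rcosetsI[OF subgroup.subset[OF H(1)]] by blast
    then obtain n where "H #> x = H #> r n"
      using from_nat_into_surj[OF H(2)] r(2) by metis
    then have "x \<in> H #> r n"
      using rcos_self[OF x H(1)] by simp
    then show "\<exists>n. \<exists>h\<in>H. x = h \<otimes> r n"
      by (auto simp: r_coset_def)
  qed
qed

text \<open>Adjoining coset representatives to \<open>H\<close> one at a time gives a chain of open subgroups that
  exhausts \<open>G\<close>, hence stops.\<close>

lemma geometry_imp_finitely_generated_over_open_subgroup: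
  assumes geom: "admits_geometry G T"
    and H: "subgroup H G" "openin T H" "countable (rcosets H)"
  obtains F where "finite F" "F \<subseteq> carrier G" "generate G (H \<union> F) = carrier G"
proof -
  obtain r :: "nat \<Rightarrow> 'a" where r: "range r \<subseteq> carrier G"
    "\<And>x. x \<in> carrier G \<Longrightarrow> \<exists>n. \<exists>h\<in>H. x = h \<otimes> r n"
    using countable_index_enumeration[OF H(1,3)] by blast
  define K where "K n = generate G (H \<union> r ` {..<n})" for n
  have sub: "H \<union> r ` {..<n} \<subseteq> carrier G" for n
    using r(1) subgroup.subset[OF H(1)] by blast
  have K: "subgroup (K n) G" "H \<subseteq> K n" for n
    unfolding K_def using generate_is_subgroup[OF sub] by (auto intro: generate.incl)
  have "\<exists>n. K n = carrier G"
  proof (rule geometry_imp_chain_reaches_group[OF geom])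
    show "openin T (K 0)"
      using openin_supergroup[OF H(1,2) K] .
    show "K n \<subseteq> K (Suc n)" for n
      unfolding K_def by (intro mono_generate) (auto simp: less_Suc_eq)
    show "carrier G = (\<Union>n. K n)"
    proof
      show "carrier G \<subseteq> (\<Union>n. K n)"
      proof
        fix x assume "x \<in> carrier G"
        then obtain n h where nh: "h \<in> H" "x = h \<otimes> r n"
          using r(2) by blast
        then have "h \<in> K (Suc n)" "r n \<in> K (Suc n)"
          unfolding K_def by (auto intro: generate.incl)
        then have "x \<in> K (Suc n)"
          using nh(2) subgroup.m_closed[OF K(1)] by blast
        then show "x \<in> (\<Union>n. K n)" by blast
      qed
      show "(\<Union>n. K n) \<subseteq> carrier G"
        using subgroup.subset[OF K(1)] by blast
    qed
  qed (rule K(1))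
  then obtain n where "K n = carrier G" by blast
  with that[of "r ` {..<n}"] r(1) show thesis
    unfolding K_def by blast
qed

text \<open>The equivalence says that \<open>c\<close> identifies \<open>x\<close> and \<open>y\<close> when \<open>xH = yH\<close>, so the values of
  \<open>c\<close> are a copy of \<open>G/H\<close> inside the natural numbers. Inversion turns the countably many right
  cosets into left ones, on which \<open>G\<close> acts.\<close>

lemma lcoset_numbering:
  assumes H: "subgroup H G" "countable (rcosets H)"
  obtains c :: "'a \<Rightarrow> nat" where
    "\<And>x y. x \<in> carrier G \<Longrightarrow> y \<in> carrier G \<Longrightarrow> c x = c y \<longleftrightarrow> inv x \<otimes> y \<in> H"
proof
  fix x y assume xy: "x \<in> carrier G" "y \<in> carrier G"
  interpret H: subgroup H G by fact
  have "to_nat_on (rcosets H) (H #> inv x) = to_nat_on (rcosets H) (H #> inv y)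
      \<longleftrightarrow> H #> inv x = H #> inv y"
    using xy H.subset H(2) by (intro to_nat_on_inj) (auto intro: rcosetsI)
  also have "\<dots> \<longleftrightarrow> inv x \<in> H #> inv y"
    using xy H(1) rcos_self[of "inv x" H] repr_independence[of "inv x" H "inv y"] by auto
  also have "\<dots> \<longleftrightarrow> inv x \<otimes> y \<in> H"
  proof
    assume "inv x \<in> H #> inv y"
    then obtain h where h: "h \<in> H" "inv x = h \<otimes> inv y" by (auto simp: r_coset_def)
    then show "inv x \<otimes> y \<in> H" using xy by (simp add: m_assoc)
  next
    assume "inv x \<otimes> y \<in> H"
    moreover have "inv x = (inv x \<otimes> y) \<otimes> inv y" using xy by (simp add: m_assoc)
    ultimately show "inv x \<in> H #> inv y" unfolding r_coset_def by blast
  qed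
  finally show "to_nat_on (rcosets H) (H #> inv x) = to_nat_on (rcosets H) (H #> inv y)
      \<longleftrightarrow> inv x \<otimes> y \<in> H" .
qed

text \<open>The coset graph serves. The stabilizer of \<open>gH\<close> is
  the conjugate of \<open>H\<close> by \<open>g\<close>, each \<open>f \<in> F\<close> contributes at most one orbit of edges, and
  connectedness amounts to \<open>H \<union> F\<close> generating \<open>G\<close>.\<close>

lemma admits_CAR_graph_if_finitely_generated_over:
  assumes H: "subgroup H G" "openin T H" "countable (rcosets H)" "coarsely_bounded G T H"
    and F: "finite F" "F \<subseteq> carrier G" "generate G (H \<union> F) = carrier G"
  shows "admits_CAR_graph G T"
proof -
  interpret H: subgroup H G by fact
  obtain c :: "'a \<Rightarrow> nat" where
    c: "\<And>x y. x \<in> carrier G \<Longrightarrow> y \<in> carrier G \<Longrightarrow> c x = c y \<longleftrightarrow> inv x \<otimes> y \<in> H"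
    using lcoset_numbering[OF H(1,3)] by blast
  define V where "V = c ` carrier G"
  define s where "s = inv_into (carrier G) c"
  have s: "s v \<in> carrier G" "c (s v) = v" if "v \<in> V" for v
    using that unfolding V_def s_def by (auto intro: inv_into_into f_inv_into_f)
  define \<phi> where "\<phi> g = (\<lambda>v\<in>V. c (g \<otimes> s v))" for g
  have cV: "c x \<in> V" if "x \<in> carrier G" for x
    using that by (simp add: V_def)
  have c_mult: "c (g \<otimes> x) = c (g \<otimes> y)"
    if "g \<in> carrier G" "x \<in> carrier G" "y \<in> carrier G" "c x = c y" for g x y
    using that c by (simp add: inv_mult_left_cancel)
  have \<phi>_c: "\<phi> g (c x) = c (g \<otimes> x)" if "g \<in> carrier G" "x \<in> carrier G" for g x
    using that c_mult[of g "s (c x)" x] s cV by (simp add: \<phi>_def)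
  have \<phi>_ext: "\<phi> g \<in> extensional V" for g
    by (simp add: \<phi>_def)
  have \<phi>_mult: "\<phi> (g \<otimes> h) v = \<phi> g (\<phi> h v)" if "g \<in> carrier G" "h \<in> carrier G" "v \<in> V" for g h v
    using that unfolding V_def by (auto simp: \<phi>_c m_assoc)
  have \<phi>_one: "\<phi> \<one> v = v" if "v \<in> V" for v
    using that unfolding V_def by (auto simp: \<phi>_c)
  have \<phi>_V: "\<phi> g v \<in> V" if "g \<in> carrier G" "v \<in> V" for g v
    using that unfolding V_def by (auto simp: \<phi>_c)
  have bij: "\<phi> g \<in> Bij V" if g: "g \<in> carrier G" for g
  proof -
    have "bij_betw (\<phi> g) V V"
      using g \<phi>_V \<phi>_mult[of g "inv g", symmetric] \<phi>_mult[of "inv g" g, symmetric] \<phi>_one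
      by (intro bij_betw_byWitness[where f' = "\<phi> (inv g)"]) auto
    then show ?thesis using \<phi>_ext by (simp add: Bij_def)
  qed
  have "\<phi> \<in> hom G (BijGroup V)"
  proof (rule homI)
    fix g h assume gh: "g \<in> carrier G" "h \<in> carrier G"
    have "\<phi> (g \<otimes> h) = compose V (\<phi> g) (\<phi> h)"
      using gh by (intro extensionalityI[OF \<phi>_ext compose_extensional]) (simp add: compose_eq \<phi>_mult)
    then show "\<phi> (g \<otimes> h) = \<phi> g \<otimes>\<^bsub>BijGroup V\<^esub> \<phi> h"
      using gh bij by (simp add: BijGroup_def)
  qed (simp add: BijGroup_def bij)
  then have "group_action G V \<phi>"
    by (simp add: group_action_def group_hom_def group_hom_axioms_def group_BijGroup is_group)
  moreover have "\<exists>g\<in>carrier G. \<phi> g u = v" if "u \<in> V" "v \<in> V" for u v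
  proof
    show "s v \<otimes> inv (s u) \<in> carrier G" using s that by simp
    have "\<phi> (s v \<otimes> inv (s u)) (c (s u)) = c (s v)"
      using s(1)[OF that(1)] s(1)[OF that(2)] by (simp add: \<phi>_c m_assoc)
    then show "\<phi> (s v \<otimes> inv (s u)) u = v"
      by (simp only: s(2)[OF that(1)] s(2)[OF that(2)])
  qed
  ultimately have trans: "transitive_action G V \<phi>"
    by (simp add: transitive_action_def transitive_action_axioms_def)
  define E where "E = {{c g, c (g \<otimes> f)} | g f. g \<in> carrier G \<and> f \<in> F \<and> f \<notin> H}"
  have c_f: "c (g \<otimes> f) = c g \<longleftrightarrow> f \<in> H" if "g \<in> carrier G" "f \<in> carrier G" for g f
    using that c[of g "g \<otimes> f"] by (auto simp: m_assoc[symmetric])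
  have simple: "simple_graph V E"
    unfolding simple_graph_def
  proof
    fix e assume "e \<in> E"
    then obtain g f where e: "e = {c g, c (g \<otimes> f)}" "g \<in> carrier G" "f \<in> F" "f \<notin> H"
      unfolding E_def by blast
    then have "f \<in> carrier G" using F(2) by blast
    then show "e \<subseteq> V \<and> card e = 2"
      unfolding e(1) using e(2,4) c_f[of g f] cV by (simp add: card_2_iff)
  qed
  have \<phi>_edge: "\<phi> k ` {c g, c (g \<otimes> f)} = {c (k \<otimes> g), c (k \<otimes> g \<otimes> f)}"
    if "k \<in> carrier G" "g \<in> carrier G" "f \<in> carrier G" for k g f
    using that by (simp add: \<phi>_c m_assoc)
  have aut: "\<forall>g\<in>carrier G. \<forall>e\<in>E. \<phi> g ` e \<in> E"
  proof (intro ballI)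
    fix k e assume k: "k \<in> carrier G" and "e \<in> E"
    then obtain g f where e: "e = {c g, c (g \<otimes> f)}" "g \<in> carrier G" "f \<in> F" "f \<notin> H"
      unfolding E_def by blast
    then have "\<phi> k ` e = {c (k \<otimes> g), c (k \<otimes> g \<otimes> f)}"
      using \<phi>_edge k F(2) by blast
    then show "\<phi> k ` e \<in> E"
      unfolding E_def using e k by blast
  qed
  have "orbits G E (\<lambda>g e. \<phi> g ` e) \<subseteq> (\<lambda>f. {{c x, c (x \<otimes> f)} | x. x \<in> carrier G}) ` F"
  proof
    fix X assume "X \<in> orbits G E (\<lambda>g e. \<phi> g ` e)"
    then obtain g f where e: "X = orbit G (\<lambda>g e. \<phi> g ` e) {c g, c (g \<otimes> f)}"
        "g \<in> carrier G" "f \<in> F" "f \<notin> H"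
      unfolding E_def orbits_def by blast
    have f: "f \<in> carrier G" using e F by blast
    have "X = {{c x, c (x \<otimes> f)} | x. x \<in> carrier G}"
    proof (intro equalityI subsetI)
      fix y assume "y \<in> X"
      then obtain k where k: "k \<in> carrier G" "y = \<phi> k ` {c g, c (g \<otimes> f)}"
        unfolding e(1) orbit_def by blast
      then show "y \<in> {{c x, c (x \<otimes> f)} | x. x \<in> carrier G}"
        using \<phi>_edge[OF k(1) e(2) f] e(2) by blast
    next
      fix y assume "y \<in> {{c x, c (x \<otimes> f)} | x. x \<in> carrier G}"
      then obtain x where x: "x \<in> carrier G" "y = {c x, c (x \<otimes> f)}" by blast
      have "y = \<phi> (x \<otimes> inv g) ` {c g, c (g \<otimes> f)}"
        using \<phi>_edge[of "x \<otimes> inv g" g f] x e(2) f by (simp add: m_assoc)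
      then show "y \<in> X"
        unfolding e(1) orbit_def using x e(2) by blast
    qed
    then show "X \<in> (\<lambda>f. {{c x, c (x \<otimes> f)} | x. x \<in> carrier G}) ` F"
      using e(3) by blast
  qed
  then have fin: "finite (orbits G E (\<lambda>g e. \<phi> g ` e))"
    using F(1) finite_subset by blast
  let ?R = "{(x, y). {x, y} \<in> E}"
  have step: "(c g, c (g \<otimes> f)) \<in> ?R\<^sup>*" "(c (g \<otimes> f), c g) \<in> ?R\<^sup>*" if "g \<in> carrier G" "f \<in> F" for g f
  proof -
    have "(c g, c (g \<otimes> f)) \<in> ?R\<^sup>* \<and> (c (g \<otimes> f), c g) \<in> ?R\<^sup>*"
    proof (cases "f \<in> H")
      case True
      then have "c (g \<otimes> f) = c g" using c_f that F(2) by blast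
      then show ?thesis by simp
    next
      case False
      then have "{c g, c (g \<otimes> f)} \<in> E" unfolding E_def using that by blast
      then show ?thesis by (auto simp: insert_commute)
    qed
    then show "(c g, c (g \<otimes> f)) \<in> ?R\<^sup>*" "(c (g \<otimes> f), c g) \<in> ?R\<^sup>*" by auto
  qed
  have carrier_gen: "generate G (H \<union> F) \<subseteq> carrier G" using F(3) by simp
  \<comment> \<open>The start \<open>g\<close> is arbitrary: the path for a product continues from where the first factor led.\<close>
  have path: "\<forall>g\<in>carrier G. (c g, c (g \<otimes> x)) \<in> ?R\<^sup>*" if "x \<in> generate G (H \<union> F)" for x
    using that
  proof (induction x rule: generate.induct)
    case one
    show ?case by simp
  next
    case (incl h)
    show ?case
    proof
      fix g assume g: "g \<in> carrier G"
      show "(c g, c (g \<otimes> h)) \<in> ?R\<^sup>*"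
      proof (cases "h \<in> H")
        case True
        then have "c (g \<otimes> h) = c g" using c_f[of g h] g by simp
        then show ?thesis by simp
      next
        case False
        then show ?thesis using step(1)[of g h] g incl by blast
      qed
    qed
  next
    case (inv h)
    show ?case
    proof
      fix g assume g: "g \<in> carrier G"
      show "(c g, c (g \<otimes> inv h)) \<in> ?R\<^sup>*"
      proof (cases "h \<in> H")
        case True
        then show ?thesis using c_f[of g "inv h"] g by simp
      next
        case False
        then have h: "h \<in> F" "h \<in> carrier G" using inv F(2) by auto
        then show ?thesis using step(2)[of "g \<otimes> inv h" h] g by (simp add: m_assoc)
      qed
    qed
  next
    case (eng h1 h2)
    show ?case
    proof
      fix g assume g: "g \<in> carrier G"
      have h: "h1 \<in> carrier G" "h2 \<in> carrier G" using eng carrier_gen by auto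
      have "(c g, c (g \<otimes> h1)) \<in> ?R\<^sup>*" "(c (g \<otimes> h1), c (g \<otimes> h1 \<otimes> h2)) \<in> ?R\<^sup>*"
        using eng.IH g h by auto
      then show "(c g, c (g \<otimes> (h1 \<otimes> h2))) \<in> ?R\<^sup>*"
        using g h by (simp add: m_assoc)
    qed
  qed
  have conn: "connected_graph V E"
    unfolding connected_graph_def
  proof (intro conjI ballI)
    show "V \<noteq> {}" using cV[OF one_closed] by blast
    fix u v assume uv: "u \<in> V" "v \<in> V"
    have suv: "s u \<in> carrier G" "s v \<in> carrier G"
      using s(1) uv by auto
    then have "inv (s u) \<otimes> s v \<in> generate G (H \<union> F)"
      by (simp add: F(3))
    from bspec[OF path[OF this] suv(1)]
    have "(c (s u), c (s v)) \<in> ?R\<^sup>*"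
      using suv by (simp add: m_assoc[symmetric])
    then show "(u, v) \<in> ?R\<^sup>*"
      by (simp only: s(2)[OF uv(1)] s(2)[OF uv(2)])
  qed
  have stab_open: "openin T {z \<in> carrier G. inv a \<otimes> z \<otimes> a \<in> H}" if a: "a \<in> carrier G" for a
  proof -
    have "continuous_map T (prod_topology T T) (\<lambda>z. (z, a))"
      using a by (simp add: continuous_map_pairwise o_def topspace_eq)
    from continuous_map_compose[OF this continuous_mult]
    have "continuous_map T T (\<lambda>z. z \<otimes> a)" by (simp add: o_def)
    from openin_continuous_map_preimage[OF this openin_lcoset[OF H(2) a]]
    have "openin T {z \<in> carrier G. z \<otimes> a \<in> carrier G \<and> inv a \<otimes> (z \<otimes> a) \<in> H}"
      by (simp add: topspace_eq)
    also have "{z \<in> carrier G. z \<otimes> a \<in> carrier G \<and> inv a \<otimes> (z \<otimes> a) \<in> H}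
        = {z \<in> carrier G. inv a \<otimes> z \<otimes> a \<in> H}"
      using a by (auto simp: m_assoc)
    finally show ?thesis .
  qed
  have stab: "stabilizer G \<phi> (c a) = {z \<in> carrier G. inv a \<otimes> z \<otimes> a \<in> H}"
    if a: "a \<in> carrier G" for a
  proof -
    have "\<phi> z (c a) = c a \<longleftrightarrow> inv a \<otimes> z \<otimes> a \<in> H" if "z \<in> carrier G" for z
      using c[of a "z \<otimes> a"] a that by (auto simp: \<phi>_c m_assoc)
    then show ?thesis by (auto simp: stabilizer_def)
  qed
  have cont: "continuous_map (prod_topology T (discrete_topology V)) (discrete_topology V)
       (\<lambda>(g, v). \<phi> g v)"
    unfolding continuous_map_def
  proof (intro conjI allI impI)
    show "(\<lambda>(g, v). \<phi> g v) \<in> topspace (prod_topology T (discrete_topology V)) \<rightarrow> topspace (discrete_topology V)"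
      using \<phi>_V by (auto simp: topspace_eq)
    fix U assume "openin (discrete_topology V) U"
    show "openin (prod_topology T (discrete_topology V))
        {p \<in> topspace (prod_topology T (discrete_topology V)). (case p of (g, v) \<Rightarrow> \<phi> g v) \<in> U}"
      unfolding openin_prod_topology_alt
    proof (intro allI impI)
      fix k v
      assume "(k, v) \<in> {p \<in> topspace (prod_topology T (discrete_topology V)). (case p of (g, v) \<Rightarrow> \<phi> g v) \<in> U}"
      then have kv: "k \<in> carrier G" "v \<in> V" "\<phi> k v \<in> U" by (auto simp: topspace_eq)
      define S where "S = {z \<in> carrier G. inv (s v) \<otimes> z \<otimes> s v \<in> H}"
      have S: "S = stabilizer G \<phi> v" using stab[of "s v"] s kv by (simp add: S_def)
      have coset: "\<phi> g v = \<phi> k v" if "g \<in> carrier G" "inv k \<otimes> g \<in> S" for g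
      proof -
        have "\<phi> g v = \<phi> (k \<otimes> (inv k \<otimes> g)) v"
          using that kv by (simp add: m_assoc[symmetric])
        also have "\<dots> = \<phi> k v"
          using that kv \<phi>_mult[of k "inv k \<otimes> g" v] unfolding S stabilizer_def by simp
        finally show ?thesis .
      qed
      have S_open: "openin T {g \<in> carrier G. inv k \<otimes> g \<in> S}"
        using openin_lcoset stab_open s kv unfolding S_def by blast
      have one: "\<one> \<in> S"
        unfolding S stabilizer_def using kv \<phi>_one by simp
      show "\<exists>A B. openin T A \<and> openin (discrete_topology V) B \<and> k \<in> A \<and> v \<in> B \<and>
          A \<times> B \<subseteq> {p \<in> topspace (prod_topology T (discrete_topology V)). (case p of (g, v) \<Rightarrow> \<phi> g v) \<in> U}"
      proof (intro exI conjI subsetI)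
        fix q assume "q \<in> {g \<in> carrier G. inv k \<otimes> g \<in> S} \<times> {v}"
        then obtain g where g: "q = (g, v)" "g \<in> carrier G" "inv k \<otimes> g \<in> S" by blast
        then show "q \<in> {p \<in> topspace (prod_topology T (discrete_topology V)). (case p of (g, v) \<Rightarrow> \<phi> g v) \<in> U}"
          using coset[OF g(2,3)] kv by (simp add: topspace_eq)
      qed (use S_open one kv in auto)
    qed
  qed
  have "\<forall>v\<in>V. coarsely_bounded G T (stabilizer G \<phi> v)"
    unfolding V_def using stab coarsely_bounded_conjugate[OF H(4)] by simp
  then have "CAR_graph G T V E \<phi>"
    unfolding CAR_graph_def using simple conn trans aut cont fin by simp
  then show ?thesis unfolding admits_CAR_graph_def by blast
qed

end

section \<open>From a Cayley--Abels--Rosendal graph to a geometry\<close>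

text \<open>The value is unspecified between points that no path joins.\<close>

definition path_dist :: "('v \<times> 'v) set \<Rightarrow> 'v \<Rightarrow> 'v \<Rightarrow> nat" where
  "path_dist R u v = (LEAST n. (u, v) \<in> R ^^ n)"

lemma path_dist_relpow:
  assumes "(u, v) \<in> R\<^sup>*"
  shows "(u, v) \<in> R ^^ path_dist R u v"
  unfolding path_dist_def by (rule LeastI_ex[OF rtrancl_imp_relpow[OF assms]])

lemma path_dist_le: "(u, v) \<in> R ^^ n \<Longrightarrow> path_dist R u v \<le> n"
  unfolding path_dist_def by (rule Least_le)

lemma path_dist_triangle:
  assumes "(u, v) \<in> R\<^sup>*" "(v, w) \<in> R\<^sup>*"
  shows "path_dist R u w \<le> path_dist R u v + path_dist R v w"
  by (rule path_dist_le[OF relpow_trans[OF path_dist_relpow[OF assms(1)] path_dist_relpow[OF assms(2)]]])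

lemma relpow_map:
  assumes "\<And>x y. (x, y) \<in> R \<Longrightarrow> (f x, f y) \<in> R" "(u, v) \<in> R ^^ n"
  shows "(f u, f v) \<in> R ^^ n"
  using assms(2)
proof (induction n arbitrary: v)
  case (Suc n)
  then obtain y where "(u, y) \<in> R ^^ n" "(y, v) \<in> R" by auto
  then show ?case using relpow_Suc_I[OF Suc.IH assms(1)] by blast
qed simp

lemma relpow_sym:
  assumes "sym R" "(u, v) \<in> R ^^ n"
  shows "(v, u) \<in> R ^^ n"
  using assms(2)
proof (induction n arbitrary: v)
  case (Suc n)
  then obtain y where "(u, y) \<in> R ^^ n" "(y, v) \<in> R" by auto
  then show ?case using relpow_Suc_I2[OF symD[OF assms(1)] Suc.IH] by blast
qed simp

text \<open>The displacement of a base vertex in the graph metric is maximal. The reason is a Milnor--Schwarz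
  argument: translating an edge to one of finitely many representatives shows that a competing
  pseudometric moves a bounded amount along each edge, up to the coarsely bounded ambiguity of the
  stabilizer, and these bounds add up along a path.\<close>

lemma (in topological_group) CAR_graph_imp_geometry:
  assumes car: "CAR_graph G T V E \<phi>"
  shows "admits_geometry G T"
proof -
  have simple: "simple_graph V E" and conn: "connected_graph V E"
    and trans: "transitive_action G V \<phi>"
    and aut: "\<And>g e. g \<in> carrier G \<Longrightarrow> e \<in> E \<Longrightarrow> \<phi> g ` e \<in> E"
    and cont: "continuous_map (prod_topology T (discrete_topology V)) (discrete_topology V)
       (\<lambda>(g, v). \<phi> g v)"
    and fin: "finite (orbits G E (\<lambda>g e. \<phi> g ` e))"
    and bdd: "\<And>v. v \<in> V \<Longrightarrow> coarsely_bounded G T (stabilizer G \<phi> v)"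
    using car unfolding CAR_graph_def by auto
  interpret transitive_action G V \<phi> by fact
  obtain v0 where v0: "v0 \<in> V"
    using conn unfolding connected_graph_def by blast
  define p where "p g = \<phi> g v0" for g
  have pV: "p g \<in> V" if "g \<in> carrier G" for g
    using element_image[OF that v0] by (simp add: p_def)
  have p_mult: "p (g \<otimes> h) = \<phi> g (p h)" if "g \<in> carrier G" "h \<in> carrier G" for g h
    using composition_rule[OF v0 that] by (simp add: p_def)
  have p_surj: "\<exists>g\<in>carrier G. p g = v" if "v \<in> V" for v
    using unique_orbit[OF v0 that] by (simp add: p_def)
  define H where "H = stabilizer G \<phi> v0"
  have H: "subgroup H G"
    unfolding H_def using stabilizer_subgroup[OF v0] .
  have H_open: "openin T H"
  proof -
    have "continuous_map T (prod_topology T (discrete_topology V)) (\<lambda>g. (g, v0))"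
      using v0 by (simp add: continuous_map_pairwise o_def)
    from continuous_map_compose[OF this cont]
    have "continuous_map T (discrete_topology V) p" by (simp add: o_def p_def[abs_def])
    from openin_continuous_map_preimage[OF this, of "{v0}"] v0 show ?thesis
      by (simp add: topspace_eq H_def stabilizer_def p_def)
  qed
  have same: "inv g \<otimes> h \<in> H" if "g \<in> carrier G" "h \<in> carrier G" "p g = p h" for g h
  proof -
    have "p (inv g \<otimes> h) = \<phi> (inv g) (p g)" using p_mult that by simp
    also have "\<dots> = v0" using orbit_sym_aux[OF that(1) v0] by (simp add: p_def)
    finally show ?thesis using that by (simp add: H_def stabilizer_def p_def)
  qed
  define R where "R = {(x, y). {x, y} \<in> E}"
  have R_sym: "sym R" by (auto simp: R_def sym_def insert_commute)
  have R_conn: "(u, v) \<in> R\<^sup>*" if "u \<in> V" "v \<in> V" for u v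
    using conn that unfolding connected_graph_def R_def by blast
  have R_map: "(\<phi> g x, \<phi> g y) \<in> R" if "g \<in> carrier G" "(x, y) \<in> R" for g x y
    using aut[OF that(1), of "{x, y}"] that(2) by (simp add: R_def)
  define d where "d g h = real (path_dist R (p g) (p h))" for g h
  have d_invariant_le: "path_dist R (p (k \<otimes> g)) (p (k \<otimes> h)) \<le> path_dist R (p g) (p h)"
    if "k \<in> carrier G" "g \<in> carrier G" "h \<in> carrier G" for k g h
  proof -
    have "(p g, p h) \<in> R ^^ path_dist R (p g) (p h)"
      by (intro path_dist_relpow R_conn pV that)
    then show ?thesis
      unfolding p_mult[OF that(1,2)] p_mult[OF that(1,3)]
      by (intro path_dist_le relpow_map[of R "\<phi> k"] R_map[OF that(1)])
  qed
  have "d \<in> PMet G T"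
  proof (rule PMet_if_vanishing_on_open_subgroup[OF _ _ _ _ _ H H_open])
    fix x y assume xy: "x \<in> carrier G" "y \<in> carrier G"
    show "0 \<le> d x y" by (simp add: d_def)
    have "path_dist R (p x) (p y) \<le> path_dist R (p y) (p x)" if "x \<in> carrier G" "y \<in> carrier G" for x y
      by (rule path_dist_le[OF relpow_sym[OF R_sym path_dist_relpow[OF R_conn]]]) (simp_all add: pV that)
    from this[OF xy] this[OF xy(2,1)] show "d x y = d y x" by (simp add: d_def)
  next
    fix x
    show "d x x = 0" using path_dist_le[of "p x" "p x" 0 R] by (simp add: d_def)
  next
    fix x y z assume "x \<in> carrier G" "y \<in> carrier G" "z \<in> carrier G"
    then show "d x z \<le> d x y + d y z"
      using path_dist_triangle[OF R_conn R_conn, of "p x" "p y" "p z"] pV by (simp add: d_def)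
  next
    fix g x y assume gxy: "g \<in> carrier G" "x \<in> carrier G" "y \<in> carrier G"
    then show "d (g \<otimes> x) (g \<otimes> y) = d x y"
      using d_invariant_le[of g x y] d_invariant_le[of "inv g" "g \<otimes> x" "g \<otimes> y"]
      by (simp add: d_def m_assoc[symmetric])
  next
    fix h assume "h \<in> H"
    then have "p h = p \<one>"
      using v0 id_eq_one by (auto simp: H_def stabilizer_def p_def dest!: fun_cong[of _ _ v0])
    then show "d \<one> h = 0" using path_dist_le[of "p h" "p h" 0 R] by (simp add: d_def)
  qed
  moreover have "dominates G d d'" if d': "d' \<in> PMet G T" for d'
  proof -
    obtain D where D: "\<And>x y. x \<in> H \<Longrightarrow> y \<in> H \<Longrightarrow> d' x y \<le> D"
      using bdd[OF v0] d' unfolding coarsely_bounded_def H_def by blast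
    have D0: "D \<ge> 0"
      using D[of \<one> \<one>] PMet_refl[OF d', of \<one>] subgroup.one_closed[OF H] by simp
    have d'_same: "d' g h \<le> D" if "g \<in> carrier G" "h \<in> carrier G" "p g = p h" for g h
      using D[OF subgroup.one_closed[OF H] same[OF that]] that
        PMet_invariant[OF d', of g h "inv g"] by simp
    have step1: "d' g h \<le> 2 * D + d' a b"
      if "k \<in> carrier G" "a \<in> carrier G" "b \<in> carrier G" "g \<in> carrier G" "h \<in> carrier G"
        "p g = \<phi> k (p a)" "p h = \<phi> k (p b)" for g h k a b
      using d'_same[of g "k \<otimes> a"] d'_same[of "k \<otimes> b" h] PMet_invariant[OF d', of a b k]
        PMet_triangle[OF d', of g "k \<otimes> a" h] PMet_triangle[OF d', of "k \<otimes> a" "k \<otimes> b" h] that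
      by (simp add: p_mult)
    have "\<forall>X\<in>orbits G E (\<lambda>g e. \<phi> g ` e). \<exists>M. \<forall>g\<in>carrier G. \<forall>h\<in>carrier G.
        {p g, p h} \<in> X \<longrightarrow> d' g h \<le> M"
    proof
      fix X assume "X \<in> orbits G E (\<lambda>g e. \<phi> g ` e)"
      then obtain e where e: "e \<in> E" "X = {\<phi> k ` e | k. k \<in> carrier G}"
        unfolding orbits_def orbit_def by blast
      then obtain u w where uw: "e = {u, w}" "u \<in> V" "w \<in> V"
        using simple unfolding simple_graph_def by (metis card_2_iff insert_subset)
      then obtain a b where ab: "a \<in> carrier G" "b \<in> carrier G" "p a = u" "p b = w"
        using p_surj by metis
      show "\<exists>M. \<forall>g\<in>carrier G. \<forall>h\<in>carrier G. {p g, p h} \<in> X \<longrightarrow> d' g h \<le> M"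
      proof (intro exI ballI impI)
        fix g h assume gh: "g \<in> carrier G" "h \<in> carrier G" "{p g, p h} \<in> X"
        then obtain k where k: "k \<in> carrier G" "{p g, p h} = {\<phi> k u, \<phi> k w}"
          unfolding e(2) uw(1) by auto
        then consider "p g = \<phi> k u" "p h = \<phi> k w" | "p g = \<phi> k w" "p h = \<phi> k u"
          by (auto simp: doubleton_eq_iff)
        then show "d' g h \<le> 2 * D + d' a b"
          using step1[of k a b g h] step1[of k b a g h] ab k gh PMet_sym[OF d', of a b] by cases auto
      qed
    qed
    then obtain M where M: "\<And>X g h. X \<in> orbits G E (\<lambda>g e. \<phi> g ` e) \<Longrightarrow> g \<in> carrier G \<Longrightarrow>
        h \<in> carrier G \<Longrightarrow> {p g, p h} \<in> X \<Longrightarrow> d' g h \<le> M X"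
      by metis
    \<comment> \<open>Inserting \<open>1\<close> keeps \<open>L\<close> positive, also when there are no edges.\<close>
    define L where "L = Max (insert 1 (M ` orbits G E (\<lambda>g e. \<phi> g ` e)))"
    have L1: "L \<ge> 1" unfolding L_def using fin by simp
    have edge: "d' g h \<le> L" if "g \<in> carrier G" "h \<in> carrier G" "{p g, p h} \<in> E" for g h
    proof -
      define X where "X = orbit G (\<lambda>g e. \<phi> g ` e) {p g, p h}"
      have X: "X \<in> orbits G E (\<lambda>g e. \<phi> g ` e)"
        unfolding X_def orbits_def using that by blast
      have "\<phi> \<one> ` {p g, p h} = {p g, p h}"
        using p_mult[of \<one>] that by simp
      then have "{p g, p h} \<in> X"
        unfolding X_def orbit_def using one_closed by blast
      then have "d' g h \<le> M X" using M X that by blast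
      also have "\<dots> \<le> L" unfolding L_def using fin X by simp
      finally show ?thesis .
    qed
    have path: "d' g h \<le> L * real n + D"
      if "g \<in> carrier G" "h \<in> carrier G" "(p g, p h) \<in> R ^^ n" for g h n
      using that(2,3)
    proof (induction n arbitrary: h)
      case 0
      then show ?case using d'_same[OF that(1)] by simp
    next
      case (Suc n)
      then obtain w where w: "(p g, w) \<in> R ^^ n" "{w, p h} \<in> E"
        by (auto simp: R_def)
      then have "w \<in> V" using simple unfolding simple_graph_def by blast
      then obtain k where k: "k \<in> carrier G" "p k = w" using p_surj by blast
      have "d' g h \<le> d' g k + d' k h"
        using PMet_triangle[OF d' that(1) k(1) Suc.prems(1)] .
      also have "\<dots> \<le> (L * real n + D) + L"
        using Suc.IH[of k] edge[of k h] k w Suc.prems(1) by (intro add_mono) auto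
      finally show ?case by (simp add: algebra_simps)
    qed
    have "d' g h \<le> L * d g h + D" if "g \<in> carrier G" "h \<in> carrier G" for g h
      using path[OF that path_dist_relpow[OF R_conn[OF pV[OF that(1)] pV[OF that(2)]]]]
      by (simp add: d_def)
    then show ?thesis
      unfolding dominates_def using L1 D0 by (intro exI[of _ L] exI[of _ D] conjI) auto
  qed
  ultimately show ?thesis unfolding admits_geometry_def by blast
qed

section \<open>The equivalence\<close>

lemma (in topological_group) countable_index_imp_countably_generated_over_nbhds:
  assumes "non_archimedean G T" "open_subgroups_countable_index G T"
  shows "countably_generated_over_nbhds G T"
  unfolding countably_generated_over_nbhds_def
proof (intro allI impI)
  fix U assume U: "identity_nbhd G T U"
  then obtain H where H: "subgroup H G" "openin T H" "H \<subseteq> U"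
    using assms(1) unfolding non_archimedean_def by blast
  have "countable (rcosets H)"
    using H(1,2) assms(2) unfolding open_subgroups_countable_index_def by blast
  then obtain r :: "nat \<Rightarrow> 'a" where r: "range r \<subseteq> carrier G"
    "\<And>x. x \<in> carrier G \<Longrightarrow> \<exists>n. \<exists>h\<in>H. x = h \<otimes> r n"
    using countable_index_enumeration[OF H(1)] by blast
  have "carrier G \<subseteq> generate G (U \<union> range r)"
  proof
    fix x assume "x \<in> carrier G"
    then obtain n h where nh: "h \<in> H" "x = h \<otimes> r n" using r(2) by blast
    then have "h \<in> generate G (U \<union> range r)" "r n \<in> generate G (U \<union> range r)"
      using H(3) by (auto intro: generate.incl)
    then show "x \<in> generate G (U \<union> range r)"
      unfolding nh(2) by (rule generate.eng)
  qed
  moreover have "generate G (U \<union> range r) \<subseteq> carrier G"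
    using U r(1) by (intro generate_incl) (auto simp: identity_nbhd_def)
  ultimately show "\<exists>C. C \<subseteq> carrier G \<and> countable C \<and> generate G (U \<union> C) = carrier G"
    using r(1) by (intro exI[of _ "range r"]) auto
qed

theorem corollaryB:
  fixes G :: "('a, 'b) monoid_scheme" and T :: "'a topology"
  assumes "topological_group G T"
    and "non_archimedean G T"
    and "open_subgroups_countable_index G T"
  shows "countably_generated_over_nbhds G T \<and>
    (admits_geometry G T \<longleftrightarrow> admits_CAR_graph G T)"
proof -
  interpret topological_group G T by fact
  have "admits_CAR_graph G T" if geom: "admits_geometry G T"
  proof -
    obtain H where H: "subgroup H G" "openin T H" "coarsely_bounded G T H"
      using geometry_imp_open_coarsely_bounded_subgroup[OF assms(2) geom] by blast
    then have "countable (rcosets\<^bsub>G\<^esub> H)"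
      using assms(3) unfolding open_subgroups_countable_index_def by blast
    with H geometry_imp_finitely_generated_over_open_subgroup[OF geom]
      admits_CAR_graph_if_finitely_generated_over show ?thesis
      by metis
  qed
  then show ?thesis
    using countable_index_imp_countably_generated_over_nbhds[OF assms(2,3)] CAR_graph_imp_geometry
    unfolding admits_CAR_graph_def by blast
qed

end
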